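(* Let $n \ge d$ be positive integers and let $c_1, \ldots, c_d$ be integers with $1 \le c_1 \le c_2 \le \cdots \le c_d \le n$. Set $c_0 = 0$ and $\delta_j = c_j - c_{j-1}$ for $j \in \{1,\ldots,d\}$, and put $\boldsymbol{\delta} = (\delta_1,\ldots,\delta_d)$. Define $S : \{0,\ldots,n\}^d \to \prod_{j=1}^d \{0,\ldots,\delta_j\}$ componentwise by $$S_j(\mathbf{k}) = \min\Big(\delta_j,\ \max_{j' \in \{1,\ldots,j\}} \Big( \sum_{i=j'}^{j} k_i - \sum_{i=j'}^{j-1} \delta_i \Big)\Big), \qquad j = 1,\ldots,d .$$ Then for every $\mathbf{k} = (k_1,\ldots,k_d) \in \{0,\ldots,n\}^d$, the condition "$k_1 + \cdots + k_j \ge c_j$ for all $j \in \{1,\ldots,d\}$" holds if and only if $S(\mathbf{k}) = \boldsymbol{\delta}$. Consequently, let $-\infty = x_0 < x_1 \le \cdots \le x_d$ be real numbers, let $I_j = (x_{j-1}, x_j]$ for $j \in \{1,\ldots,d\}$, and let $X_1,\ldots,X_n$ be independent real-valued random variables with $X_i \sim F_i$. Let $C_{n,j} = \#\{k \le n : X_k \in I_j\}$, $\mathbf{C}_n = (C_{n,1},\ldots,C_{n,d})$, and let $E_{n,1:d} = \bigcap_{j=1}^d \{C_{n,1} + \cdots + C_{n,j} \ge c_j\}$. Then the event $E_{n,1:d}$ holds if and only if $S(\mathbf{C}_n) = \boldsymbol{\delta}$, and hence $\mathbb{P}(S(\mathbf{C}_n) = \boldsymbol{\delta}) = \mathbb{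P}(E_{n,1:d})$.
   Context: The event $E_{n,1:d}$ coincides with the event $\{X_{(c_1)} \le x_1, \ldots, X_{(c_d)} \le x_d\}$, where $X_{(c)}$ denotes the $c$-th smallest of $X_1,\ldots,X_n$. Here $\#$ denotes cardinality; $C_{n,j}$ is the number of the $n$ random variables ("balls") falling in the interval ("bin") $I_j$. *)

theory Defs
  imports "HOL-Probability.Probability"
begin

text \<open>
  A vector indexed by \<open>1, ..., d\<close> is an extensional function on \<open>{1..d}\<close>, so equality of
  vectors is equality of functions.
\<close>

definition increments :: "nat \<Rightarrow> (nat \<Rightarrow> int) \<Rightarrow> (nat \<Rightarrow> int)" where
  "increments d c = (\<lambda>j\<in>{1..d}. c j - c (j - 1))"

definition S_map :: "nat \<Rightarrow> (nat \<Rightarrow> int) \<Rightarrow> (nat \<Rightarrow> int) \<Rightarrow> (nat \<Rightarrow> int)" where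
  "S_map d \<delta> k =
     (\<lambda>j\<in>{1..d}. min (\<delta> j) (MAX j'\<in>{1..j}. (\<Sum>i\<in>{j'..j}. k i) - (\<Sum>i\<in>{j'..<j}. \<delta> i)))"

text \<open>The thresholds are extended reals so that the left end of the first bin can be \<open>-\<infinity>\<close>.\<close>

definition bin :: "(nat \<Rightarrow> ereal) \<Rightarrow> nat \<Rightarrow> real set" where
  "bin x j = {y. x (j - 1) < ereal y \<and> ereal y \<le> x j}"

definition bin_counts ::
    "nat \<Rightarrow> nat \<Rightarrow> (nat \<Rightarrow> ereal) \<Rightarrow> (nat \<Rightarrow> 'a \<Rightarrow> real) \<Rightarrow> 'a \<Rightarrow> (nat \<Rightarrow> int)" where
  "bin_counts n d x X \<omega> = (\<lambda>j\<in>{1..d}. int (card {i \<in> {1..n}. X i \<omega> \<in> bin x j}))"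

definition E_event ::
    "'a measure \<Rightarrow> nat \<Rightarrow> nat \<Rightarrow> (nat \<Rightarrow> int) \<Rightarrow> (nat \<Rightarrow> ereal) \<Rightarrow> (nat \<Rightarrow> 'a \<Rightarrow> real) \<Rightarrow> 'a set" where
  "E_event M n d c x X =
     (\<Inter>j\<in>{1..d}. {\<omega> \<in> space M. (\<Sum>i\<in>{1..j}. bin_counts n d x X \<omega> i) \<ge> c j})"

end

theory Submission
  imports Defs
begin

text \<open>
  Put \<open>D j = k 1 + \<dots> + k j - c j\<close>, so that \<open>D 0 = 0\<close>. The sums telescope, and \<open>S j = \<delta> j\<close> says
  exactly that \<open>D j \<ge> D i\<close> for some \<open>i < j\<close>. If this holds for every \<open>j\<close>, then strong induction
  gives \<open>D j \<ge> D 0 = 0\<close> for every \<open>j\<close>; conversely, if \<open>D j \<ge> 0\<close>, then \<open>i = 0\<close> is a witness.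
\<close>

lemma sum_increments:
  assumes "1 \<le> a" "a \<le> j" "j \<le> d"
  shows "(\<Sum>i\<in>{a..<j}. increments d c i) = c (j - 1) - c (a - 1)"
proof -
  \<comment> \<open>All indices lie in \<open>{1..d}\<close>, where \<open>increments\<close> is a
    true difference and not the default value of the restriction.\<close>
  have "(\<Sum>i\<in>{a..<j}. increments d c i) = (\<Sum>i\<in>{a..<j}. c i - c (i - 1))"
    using assms by (intro sum.cong) (auto simp: increments_def)
  also have "\<dots> = c (j - 1) - c (a - 1)"
    using assms(2,1) by (induction j rule: dec_induct) (auto simp: sum.atLeastLessThan_Suc)
  finally show ?thesis .
qed

lemma sum_atLeastAtMost_diff:
  fixes k :: "nat \<Rightarrow> int"
  assumes "1 \<le> a" "a \<le> j"
  shows "(\<Sum>i\<in>{a..j}. k i) = (\<Sum>i\<in>{1..j}. k i) - (\<Sum>i\<in>{1..a - 1}. k i)"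
proof -
  have "{1..j} = {1..a - 1} \<union> {a..j}" "{1..a - 1} \<inter> {a..j} = {}"
    using assms by auto
  then show ?thesis by (simp add: sum.union_disjoint)
qed

lemma S_map_eq_increment_iff:
  assumes "j \<in> {1..d}"
  shows "S_map d (increments d c) k j = increments d c j \<longleftrightarrow>
    (\<exists>i<j. (\<Sum>l\<in>{1..i}. k l) - c i \<le> (\<Sum>l\<in>{1..j}. k l) - c j)"
proof -
  let ?D = "\<lambda>i. (\<Sum>l\<in>{1..i}. k l) - c i"
  let ?f = "\<lambda>a. (\<Sum>i\<in>{a..j}. k i) - (\<Sum>i\<in>{a..<j}. increments d c i)"
  \<comment> \<open>Telescoping gives \<open>?f a = ?D j - ?D (a - 1) + increments d c j\<close>, so
    a start index \<open>a\<close> corresponds to the witness \<open>i = a - 1\<close>.\<close>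
  have f: "increments d c j \<le> ?f a \<longleftrightarrow> ?D (a - 1) \<le> ?D j" if "a \<in> {1..j}" for a
    using that assms sum_increments[of a j d c] sum_atLeastAtMost_diff[of a j k]
    by (auto simp: increments_def)
  have "S_map d (increments d c) k j = increments d c j \<longleftrightarrow>
      increments d c j \<le> (MAX a\<in>{1..j}. ?f a)"
    using assms by (auto simp: S_map_def min_def)
  also have "\<dots> \<longleftrightarrow> (\<exists>a\<in>{1..j}. increments d c j \<le> ?f a)"
    using assms by (subst Max_ge_iff) auto
  also have "\<dots> \<longleftrightarrow> (\<exists>a\<in>{1..j}. ?D (a - 1) \<le> ?D j)"
    using f by (rule bex_cong[OF refl])
  also have "\<dots> \<longleftrightarrow> (\<exists>i<j. ?D i \<le> ?D j)"
  proof
    assume "\<exists>a\<in>{1..j}. ?D (a - 1) \<le> ?D j"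
    then obtain a where "a \<in> {1..j}" "?D (a - 1) \<le> ?D j" by blast
    then show "\<exists>i<j. ?D i \<le> ?D j" by (intro exI[of _ "a - 1"]) auto
  next
    assume "\<exists>i<j. ?D i \<le> ?D j"
    then obtain i where "i < j" "?D i \<le> ?D j" by blast
    then show "\<exists>a\<in>{1..j}. ?D (a - 1) \<le> ?D j" by (intro bexI[of _ "Suc i"]) auto
  qed
  finally show ?thesis .
qed

lemma partial_sums_ge_iff_S_map_eq:
  assumes "c 0 = 0"
  shows "(\<forall>j\<in>{1..d}. (\<Sum>i\<in>{1..j}. k i) \<ge> c j) \<longleftrightarrow>
    S_map d (increments d c) k = increments d c"
proof -
  let ?D = "\<lambda>i. (\<Sum>l\<in>{1..i}. k l) - c i"
  have ext: "S_map d (increments d c) k \<in> extensional {1..d}"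
    "increments d c \<in> extensional {1..d}"
    unfolding S_map_def increments_def by (rule restrict_extensional)+
  \<comment> \<open>Both sides are extensional on \<open>{1..d}\<close>, so their equality as
    functions is equality at each index there.\<close>
  have "S_map d (increments d c) k = increments d c \<longleftrightarrow>
      (\<forall>j\<in>{1..d}. S_map d (increments d c) k j = increments d c j)"
    using extensionalityI[OF ext] by auto
  also have "\<dots> \<longleftrightarrow> (\<forall>j\<in>{1..d}. \<exists>i<j. ?D i \<le> ?D j)"
    using S_map_eq_increment_iff by (rule ball_cong[OF refl])
  also have "\<dots> \<longleftrightarrow> (\<forall>j\<in>{1..d}. 0 \<le> ?D j)"
  proof
    assume *: "\<forall>j\<in>{1..d}. \<exists>i<j. ?D i \<le> ?D j"
    \<comment> \<open>The witness below \<open>j\<close> may be 0, which is outside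
      \<open>{1..d}\<close>, so the induction claim covers index 0 as well.\<close>
    have "j \<le> d \<Longrightarrow> 0 \<le> ?D j" for j
    proof (induction j rule: less_induct)
      case (less j)
      show ?case
      proof (cases "j = 0")
        case True
        then show ?thesis using assms by simp
      next
        case False
        then have "j \<in> {1..d}" using less.prems by simp
        with * obtain i where i: "i < j" "?D i \<le> ?D j" by blast
        with less.IH[of i] less.prems show ?thesis by linarith
      qed
    qed
    then show "\<forall>j\<in>{1..d}. 0 \<le> ?D j" by simp
  next
    assume "\<forall>j\<in>{1..d}. 0 \<le> ?D j"
    then show "\<forall>j\<in>{1..d}. \<exists>i<j. ?D i \<le> ?D j"
      using assms by (intro ballI exI[of _ 0]) auto
  qed
  finally show ?thesis by simp
qed

text \<open>The \<open>min\<close> gives the upper bound. For the lower bound, the term of the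
  maximum with start index \<open>j\<close> subtracts an empty sum, so it is \<open>k j\<close>,
  which is nonnegative.\<close>

lemma S_map_in_PiE:
  assumes "\<And>j. j \<in> {1..d} \<Longrightarrow> 0 \<le> \<delta> j" and "\<And>j. j \<in> {1..d} \<Longrightarrow> 0 \<le> k j"
  shows "S_map d \<delta> k \<in> (\<Pi>\<^sub>E j\<in>{1..d}. {0..\<delta> j})"
proof (rule PiE_I)
  fix j assume j: "j \<in> {1..d}"
  let ?f = "\<lambda>a. (\<Sum>i\<in>{a..j}. k i) - (\<Sum>i\<in>{a..<j}. \<delta> i)"
  have "k j = ?f j" by simp
  also have "\<dots> \<le> (MAX a\<in>{1..j}. ?f a)"
    using j by (intro Max_ge imageI) auto
  finally have "0 \<le> (MAX a\<in>{1..j}. ?f a)"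
    using assms(2)[OF j] by linarith
  then show "S_map d \<delta> k j \<in> {0..\<delta> j}"
    using j assms(1)[OF j] by (simp add: S_map_def)
qed (auto simp: S_map_def)

text \<open>Used for the bin counts and for their partial sums. With the discrete sigma-algebra on
  the integers, preimages of all sets, in particular of \<open>{c j..}\<close>, are
  measurable.\<close>

lemma measurable_sum_int:
  fixes f :: "'b \<Rightarrow> 'a \<Rightarrow> int"
  assumes "\<And>i. i \<in> A \<Longrightarrow> f i \<in> measurable M (count_space UNIV)"
  shows "(\<lambda>\<omega>. \<Sum>i\<in>A. f i \<omega>) \<in> measurable M (count_space UNIV)"
  using assms
proof (induction A rule: infinite_finite_induct)
  case (insert a A)
  then have [measurable]: "f a \<in> measurable M (count_space UNIV)"
    "(\<lambda>\<omega>. \<Sum>i\<in>A. f i \<omega>) \<in> measurable M (count_space UNIV)"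
    by auto
  have "(\<lambda>\<omega>. f a \<omega> + (\<Sum>i\<in>A. f i \<omega>)) \<in> measurable M (count_space UNIV)"
    by measurable
  with insert.hyps show ?case by simp
qed auto

text \<open>Each count is a finite sum of indicators of measurable events. Positivity of
  \<open>d\<close> matters: an empty intersection would be \<open>UNIV\<close> instead of
  \<open>space M\<close>.\<close>

lemma E_event_measurable:
  assumes "0 < d" and "\<And>i. i \<in> {1..n} \<Longrightarrow> X i \<in> borel_measurable M"
  shows "E_event M n d c x X \<in> sets M"
proof -
  have ind: "(\<lambda>\<omega>. if X i \<omega> \<in> bin x l then 1 else (0::int)) \<in> measurable M (count_space UNIV)"
    if "i \<in> {1..n}" for i l
  proof -
    note assms(2)[OF that, measurable]
    show ?thesis unfolding bin_def by measurable
  qed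
  have count: "(\<lambda>\<omega>. bin_counts n d x X \<omega> l) \<in> measurable M (count_space UNIV)" for l
  proof (cases "l \<in> {1..d}")
    case True
    then have "bin_counts n d x X \<omega> l = (\<Sum>i\<in>{1..n}. if X i \<omega> \<in> bin x l then 1 else 0)" for \<omega>
      by (simp add: bin_counts_def sum.If_cases Int_def)
    then show ?thesis using measurable_sum_int[of "{1..n}", OF ind[of _ l]] by simp
  next
    \<comment> \<open>Outside \<open>{1..d}\<close> the count is the constant
      \<open>undefined\<close>, so measurability holds for every \<open>l\<close> and the partial
      sums below need no bound on \<open>j\<close>.\<close>
    case False
    then have "bin_counts n d x X \<omega> l = undefined" for \<omega>
      unfolding bin_counts_def by (simp only: restrict_apply if_False)
    then show ?thesis by simp
  qed
  have "{\<omega> \<in> space M. (\<Sum>i\<in>{1..j}. bin_counts n d x X \<omega> i) \<ge> c j} \<in> sets M" for j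
  proof -
    have "{\<omega> \<in> space M. (\<Sum>i\<in>{1..j}. bin_counts n d x X \<omega> i) \<ge> c j} =
        (\<lambda>\<omega>. \<Sum>i\<in>{1..j}. bin_counts n d x X \<omega> i) -` {c j..} \<inter> space M"
      by auto
    also have "\<dots> \<in> sets M"
      by (rule measurable_sets[OF measurable_sum_int[OF count]]) simp
    finally show ?thesis .
  qed
  with assms(1) show ?thesis
    unfolding E_event_def by (intro sets.finite_INT) auto
qed

theorem theorem1:
  fixes n d :: nat and c :: "nat \<Rightarrow> int"
  assumes "0 < d" and "d \<le> n"
    and "c 0 = 0"
    and "1 \<le> c 1" and "\<forall>j\<in>{1..<d}. c j \<le> c (Suc j)" and "c d \<le> int n"
  shows
    "S_map d (increments d c)
        \<in> ({1..d} \<rightarrow>\<^sub>E {0..int n}) \<rightarrow> (\<Pi>\<^sub>E j\<in>{1..d}. {0..increments d c j})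
     \<and> (\<forall>k \<in> {1..d} \<rightarrow>\<^sub>E {0..int n}.
          (\<forall>j\<in>{1..d}. (\<Sum>i\<in>{1..j}. k i) \<ge> c j)
            \<longleftrightarrow> S_map d (increments d c) k = increments d c)
     \<and> (\<forall>(M :: 'a measure) (x :: nat \<Rightarrow> ereal) (X :: nat \<Rightarrow> 'a \<Rightarrow> real)
           (F :: nat \<Rightarrow> real \<Rightarrow> real).
          prob_space M
          \<longrightarrow> x 0 = -\<infinity>
          \<longrightarrow> (\<forall>j\<in>{1..d}. \<bar>x j\<bar> \<noteq> \<infinity>)
          \<longrightarrow> (\<forall>j\<in>{1..<d}. x j \<le> x (Suc j))
          \<longrightarrow> prob_space.indep_vars M (\<lambda>_. borel) X {1..n}
          \<longrightarrow> (\<forall>i\<in>{1..n}. cdf (distr M borel (X i)) = F i)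
          \<longrightarrow> E_event M n d c x X \<in> sets M
            \<and> (\<forall>\<omega>\<in>space M. \<omega> \<in> E_event M n d c x X
                 \<longleftrightarrow> S_map d (increments d c) (bin_counts n d x X \<omega>) = increments d c)
            \<and> \<P>(\<omega> in M. S_map d (increments d c) (bin_counts n d x X \<omega>) = increments d c)
                = measure M (E_event M n d c x X))"
proof -
  have inc: "0 \<le> increments d c j" if "j \<in> {1..d}" for j
  \<comment> \<open>Monotonicity of \<open>c\<close> is assumed from index 1 on; the first increment
    is \<open>c 1 - c 0\<close>, handled by \<open>c 0 = 0\<close> and
    \<open>1 \<le> c 1\<close>.\<close>
  proof (cases "j = 1")
    case True
    with that assms(3,4) show ?thesis by (simp add: increments_def)
  next
    case False
    with that have "j - 1 \<in> {1..<d}" by auto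
    with assms(5) have "c (j - 1) \<le> c (Suc (j - 1))" by blast
    with that show ?thesis by (simp add: increments_def)
  qed
  have range: "S_map d (increments d c)
      \<in> ({1..d} \<rightarrow>\<^sub>E {0..int n}) \<rightarrow> (\<Pi>\<^sub>E j\<in>{1..d}. {0..increments d c j})"
    using inc by (intro funcsetI S_map_in_PiE) (auto simp: PiE_iff)
  note iff = partial_sums_ge_iff_S_map_eq[of c, OF assms(3)]
  \<comment> \<open>The probabilistic claims are the deterministic equivalence applied at each
    outcome to the vector of counts.\<close>
  have E: "E_event M n d c x X =
      {\<omega> \<in> space M. S_map d (increments d c) (bin_counts n d x X \<omega>) = increments d c}"
    for M :: "'a measure" and x X
  proof -
    \<comment> \<open>Nonemptiness ensures that the intersection stays inside
      \<open>space M\<close>.\<close>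
    have "{1..d} \<noteq> {}" using assms(1) by simp
    then show ?thesis unfolding E_event_def iff[symmetric] by blast
  qed
  \<comment> \<open>The definition of \<open>indep_vars\<close> includes the measurability of each
    \<open>X i\<close>.\<close>
  have meas: "E_event M n d c x X \<in> sets M"
    if "prob_space M" "prob_space.indep_vars M (\<lambda>_. borel) X {1..n}" for M :: "'a measure" and x X
    using that assms(1) by (intro E_event_measurable) (auto simp: prob_space.indep_vars_def)
  show ?thesis
    by (intro conjI allI impI ballI range iff meas; (assumption | simp add: E))
qed

end
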